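(* Let $(s_n)_{n\ge0}$ and $(t_n)_{n\ge0}$ be sequences of real numbers with $t_n\ne0$ for all $n$, and let $\alpha,\beta$ be indeterminates. Define polynomials $f_n(\alpha)$ by $f_{-1}(\alpha)=0$, $f_0(\alpha)=1$ and $$f_n(\alpha)=(\alpha+s_{n-1})f_{n-1}(\alpha)-t_{n-2}f_{n-2}(\alpha),\quad n\ge1.$$ Define $m(n,k)$ for integers $n\ge0$, $k$ by $m(0,k)=[k=0]$, $m(n,k)=0$ for $k<0$, and $$m(n,k)=m(n-1,k-1)+s_k\,m(n-1,k)+t_k\,m(n-1,k+1),\quad n\ge1,\ k\ge0,$$ and set $m_n=m(n,0)$. Then for all positive integers $n$, $$\frac{\det\left(\alpha\beta m_{i+j}+(\alpha+\beta)m_{i+j+1}+m_{i+j+2}\right)_{i,j=0}^{n-1}}{\det\left(m_{i+j}\right)_{i,j=0}^{n-1}}=\sum_{j=0}^n f_j(\alpha)f_j(\beta)\prod_{\ell=j}^{n-1}t_\ell .$$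
   Context: $[\mathcal A]$ denotes the Iverson bracket ($1$ if $\mathcal A$ is true, $0$ otherwise). Combinatorially, $m(n,k)$ is the total weight of lattice paths from $(0,0)$ to $(n,k)$ with steps $(1,1)$, $(1,0)$, $(1,-1)$ never going below the $x$-axis, where an up-step has weight $1$, a horizontal step at height $h$ has weight $s_h$, and a down-step ending at height $h$ has weight $t_h$; the weight of a path is the product of its step weights. *)

theory Defs
  imports
    "Jordan_Normal_Form.Determinant"
    "HOL-Computational_Algebra.Normalized_Fraction"
begin

text \<open>
  The ring of real polynomials in two indeterminates is \<^typ>\<open>real poly poly\<close>, with inner
  indeterminate \<open>\<alpha>\<close>, outer indeterminate \<open>\<beta>\<close> and the reals embedded as constants.
\<close>

definition konst :: "real \<Rightarrow> real poly poly" where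
  "konst c = [:[:c:]:]"

definition ind_alpha :: "real poly poly" where
  "ind_alpha = [:[:0, 1:]:]"

definition ind_beta :: "real poly poly" where
  "ind_beta = [:0, 1:]"

definition subst_poly :: "real poly \<Rightarrow> real poly poly \<Rightarrow> real poly poly" where
  "subst_poly p x = poly (map_poly konst p) x"

text \<open>
  The recurrence for index \<open>1\<close> involves \<open>f\<^sub>-\<^sub>1 = 0\<close>, whose coefficient \<open>t\<^sub>-\<^sub>1\<close> is immaterial;
  hence the second equation.
\<close>

fun f_poly :: "(nat \<Rightarrow> real) \<Rightarrow> (nat \<Rightarrow> real) \<Rightarrow> nat \<Rightarrow> real poly" where
  "f_poly s t 0 = 1"
| "f_poly s t (Suc 0) = [:s 0, 1:]"
| "f_poly s t (Suc (Suc n)) =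
     [:s (Suc n), 1:] * f_poly s t (Suc n) - smult (t n) (f_poly s t n)"

fun motzkin :: "(nat \<Rightarrow> real) \<Rightarrow> (nat \<Rightarrow> real) \<Rightarrow> nat \<Rightarrow> int \<Rightarrow> real" where
  "motzkin s t 0 k = of_bool (k = 0)"
| "motzkin s t (Suc n) k =
     (if k < 0 then 0
      else motzkin s t n (k - 1) + s (nat k) * motzkin s t n k + t (nat k) * motzkin s t n (k + 1))"

definition moment :: "(nat \<Rightarrow> real) \<Rightarrow> (nat \<Rightarrow> real) \<Rightarrow> nat \<Rightarrow> real" where
  "moment s t n = motzkin s t n 0"

end

theory Submission
  imports Defs "Jordan_Normal_Form.Char_Poly"
begin

text \<open>
  Let \<open>V\<close> be the unit lower triangular matrix of the numbers \<open>m(i, k)\<close> and \<open>D\<close> the diagonal matrix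
  of the weights \<open>t\<^sub>0 \<cdots> t\<^sub>k\<^sub>-\<^sub>1\<close>. The recurrence for \<open>m\<close> says that the tridiagonal matrix \<open>J\<close>, which is
  self-adjoint for \<open>D\<close>, shifts the rows of \<open>V\<close>; hence the Hankel matrix of the moments is
  \<open>V D V\<^sup>T\<close> and the numerator matrix is \<open>V (J + \<alpha>) D (J + \<beta>)\<^sup>T V\<^sup>T\<close>, where \<open>J + \<alpha>\<close> is cut off after
  \<open>n\<close> rows and \<open>n + 1\<close> columns. Its last column contributes to the middle factor only in the
  corner entry, which gives a recurrence in \<open>n\<close> for the determinant; the leading principal minors
  of \<open>J + \<alpha>\<close> are the \<open>f\<^sub>n(\<alpha>)\<close>.
\<close>

definition jacobi ::
    "(nat \<Rightarrow> 'a) \<Rightarrow> (nat \<Rightarrow> 'a) \<Rightarrow> 'a \<Rightarrow> nat \<Rightarrow> nat \<Rightarrow> 'a :: comm_ring_1" where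
  "jacobi s t x i j =
     (if j = i then x + s i else if j = Suc i then 1 else if i = Suc j then t j else 0)"

definition jacobi_det ::
    "(nat \<Rightarrow> 'a) \<Rightarrow> (nat \<Rightarrow> 'a) \<Rightarrow> 'a \<Rightarrow> nat \<Rightarrow> 'a :: comm_ring_1" where
  "jacobi_det s t x n = det (mat n n (\<lambda>(i, j). jacobi s t x i j))"

definition weight :: "(nat \<Rightarrow> 'a) \<Rightarrow> nat \<Rightarrow> 'a :: comm_ring_1" where
  "weight t k = (\<Prod>l<k. t l)"

text \<open>Entry of \<open>(J + x) D (J + y)^T\<close> with columns up to \<open>n\<close>. Row
  \<open>i\<close> of \<open>J + x\<close> ends at column \<open>i + 1\<close>, so rows below
  \<open>n\<close> are complete, while row \<open>n\<close> loses its last entry.\<close>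

definition jacobi_gram ::
    "(nat \<Rightarrow> 'a) \<Rightarrow> (nat \<Rightarrow> 'a) \<Rightarrow> 'a \<Rightarrow> 'a \<Rightarrow> nat \<Rightarrow> nat \<Rightarrow> nat \<Rightarrow> 'a :: comm_ring_1" where
  "jacobi_gram s t x y n i j = (\<Sum>k\<le>n. jacobi s t x i k * jacobi s t y j k * weight t k)"

lemma weight_simps [simp]: "weight t 0 = 1" "weight t (Suc k) = weight t k * t k"
  by (simp_all add: weight_def)

subsection \<open>Determinants\<close>

lemma mat_delete_last: "mat_delete (mat (Suc n) (Suc n) g) n n = mat n n g"
  by (rule eq_matI) (auto simp: mat_delete_def)

text \<open>The cofactors of the last row do not see the corner entry, so the expansion along that
  row is affine in it.\<close>

lemma det_corner:
  fixes g :: "nat \<Rightarrow> nat \<Rightarrow> 'a :: comm_ring_1"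
  shows "det (mat (Suc n) (Suc n) (\<lambda>(i, j). g i j + (if i = n \<and> j = n then c else 0))) =
         det (mat (Suc n) (Suc n) (\<lambda>(i, j). g i j)) + c * det (mat n n (\<lambda>(i, j). g i j))"
    (is "det ?A = det ?B + _")
proof -
  have del: "mat_delete ?A n j = mat_delete ?B n j" for j
    by (rule eq_matI) (auto simp: mat_delete_def)
  have "det ?A = (\<Sum>j<Suc n. ?A $$ (n, j) * cofactor ?A n j)"
    by (rule laplace_expansion_row) auto
  also have "\<dots> = (\<Sum>j<Suc n. ?B $$ (n, j) * cofactor ?B n j + (if j = n then c * cofactor ?B n n else 0))"
    by (rule sum.cong) (auto simp: cofactor_def del algebra_simps)
  also have "\<dots> = (\<Sum>j<Suc n. ?B $$ (n, j) * cofactor ?B n j) + c * cofactor ?B n n"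
    by (simp add: sum.distrib)
  also have "(\<Sum>j<Suc n. ?B $$ (n, j) * cofactor ?B n j) = det ?B"
    by (rule laplace_expansion_row [symmetric]) auto
  also have "cofactor ?B n n = det (mat n n (\<lambda>(i, j). g i j))"
    by (simp add: cofactor_def mat_delete_last)
  finally show ?thesis .
qed

text \<open>The double sum is an entry of \<open>A G B^T\<close>.\<close>

lemma det_sandwich:
  fixes a b g :: "nat \<Rightarrow> nat \<Rightarrow> 'a :: comm_ring_1"
  shows "det (mat n n (\<lambda>(i, j). \<Sum>p<n. \<Sum>q<n. a i p * g p q * b j q)) =
         det (mat n n (\<lambda>(i, j). a i j)) * det (mat n n (\<lambda>(i, j). g i j)) *
         det (mat n n (\<lambda>(i, j). b i j))"
    (is "det ?M = det ?A * det ?G * det ?B")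
proof -
  have "?M = ?A * (?G * ?B\<^sup>T)"
    by (rule eq_matI)
      (auto simp: scalar_prod_def sum_distrib_left mult.assoc atLeast0LessThan)
  moreover have "det (?A * (?G * ?B\<^sup>T)) = det ?A * det (?G * ?B\<^sup>T)"
    by (rule det_mult [of _ n]) auto
  moreover have "det (?G * ?B\<^sup>T) = det ?G * det (?B\<^sup>T)"
    by (rule det_mult [of _ n]) auto
  moreover have "det (?B\<^sup>T) = det ?B"
    by (rule det_transpose) auto
  ultimately show ?thesis
    by (simp only: mult.assoc)
qed

lemma det_diagonal:
  fixes d :: "nat \<Rightarrow> 'a :: comm_ring_1"
  shows "det (mat n n (\<lambda>(i, j). if i = j then d i else 0)) = (\<Prod>k<n. d k)"
  by (subst det_lower_triangular [of n])
    (auto simp: prod_list_diag_prod atLeast0LessThan intro!: prod.cong)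

lemma jacobi_det_0 [simp]: "jacobi_det s t x 0 = 1"
  by (simp add: jacobi_det_def)

lemma jacobi_det_1 [simp]: "jacobi_det s t x (Suc 0) = x + s 0"
  unfolding jacobi_det_def
  by (subst det_lower_triangular [of "Suc 0"]) (auto simp: prod_list_diag_prod jacobi_def)

text \<open>The last row has only two nonzero entries; expanding along it gives the three-term
  recurrence of \<open>f_poly\<close>.\<close>

lemma jacobi_det_rec:
  "jacobi_det s t x (Suc (Suc n)) =
     (x + s (Suc n)) * jacobi_det s t x (Suc n) - t n * jacobi_det s t x n"
proof -
  let ?J = "\<lambda>(i, j). jacobi s t x i j"
  let ?A = "mat (Suc (Suc n)) (Suc (Suc n)) ?J"
  let ?B = "mat_delete ?A (Suc n) n"
  have "det ?A = (\<Sum>j<Suc (Suc n). ?A $$ (Suc n, j) * cofactor ?A (Suc n) j)"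
    by (rule laplace_expansion_row) auto
  also have "\<dots> = (\<Sum>j<n. ?A $$ (Suc n, j) * cofactor ?A (Suc n) j) +
      t n * cofactor ?A (Suc n) n + (x + s (Suc n)) * cofactor ?A (Suc n) (Suc n)"
    by (simp add: jacobi_def)
  also have "(\<Sum>j<n. ?A $$ (Suc n, j) * cofactor ?A (Suc n) j) = 0"
    by (rule sum.neutral) (auto simp: jacobi_def)
  also have "cofactor ?A (Suc n) (Suc n) = jacobi_det s t x (Suc n)"
    by (simp add: cofactor_def mat_delete_last jacobi_det_def)
  also have "cofactor ?A (Suc n) n = - det ?B"
    by (simp add: cofactor_def)
  also have "det ?B = (\<Sum>i<Suc n. ?B $$ (i, n) * cofactor ?B i n)"
    by (rule laplace_expansion_column) (auto simp: mat_delete_def)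
  \<comment> \<open>The last column of \<open>?B\<close> is column \<open>n + 1\<close> of
    \<open>?A\<close>; above the deleted row it holds only the superdiagonal 1 in row
    \<open>n\<close>.\<close>
  also have "\<dots> = (\<Sum>i<Suc n. if i = n then cofactor ?B n n else 0)"
    by (rule sum.cong) (auto simp: mat_delete_def jacobi_def)
  also have "\<dots> = cofactor ?B n n"
    by simp
  also have "\<dots> = jacobi_det s t x n"
  proof -
    have "mat_delete ?B n n = mat n n ?J"
      by (rule eq_matI) (auto simp: mat_delete_def)
    then show ?thesis
      by (simp add: cofactor_def jacobi_det_def)
  qed
  finally show ?thesis
    by (simp add: jacobi_det_def)
qed

lemma det_jacobi_gram_Suc:
  "det (mat (Suc n) (Suc n) (\<lambda>(i, j). jacobi_gram s t x y (Suc n) i j)) =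
     jacobi_det s t x (Suc n) * jacobi_det s t y (Suc n) * (\<Prod>k<Suc n. weight t k) +
     weight t (Suc n) * det (mat n n (\<lambda>(i, j). jacobi_gram s t x y n i j))"
proof -
  let ?D = "\<lambda>p q. if p = q then weight t p else 0"
  \<comment> \<open>Among the rows up to \<open>n\<close>, only row \<open>n\<close> reaches column
    \<open>n + 1\<close>, with entry 1. What is left is a product of square matrices.\<close>
  have "mat (Suc n) (Suc n) (\<lambda>(i, j). jacobi_gram s t x y (Suc n) i j) =
      mat (Suc n) (Suc n) (\<lambda>(i, j). jacobi_gram s t x y n i j +
        (if i = n \<and> j = n then weight t (Suc n) else 0))"
    by (rule eq_matI) (auto simp: jacobi_gram_def jacobi_def)
  moreover have "mat (Suc n) (Suc n) (\<lambda>(i, j). jacobi_gram s t x y n i j) =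
      mat (Suc n) (Suc n)
        (\<lambda>(i, j). \<Sum>p<Suc n. \<Sum>q<Suc n. jacobi s t x i p * ?D p q * jacobi s t y j q)"
  proof (rule eq_matI; clarsimp simp del: sum.lessThan_Suc)
    fix i j
    have "(\<Sum>q<Suc n. jacobi s t x i p * ?D p q * jacobi s t y j q) =
        jacobi s t x i p * jacobi s t y j p * weight t p" if "p < Suc n" for p
    proof -
      have "(\<Sum>q<Suc n. jacobi s t x i p * ?D p q * jacobi s t y j q) =
          (\<Sum>q<Suc n. if p = q then jacobi s t x i p * jacobi s t y j p * weight t p else 0)"
        by (rule sum.cong) (auto simp: algebra_simps)
      then show ?thesis using that by (simp del: sum.lessThan_Suc)
    qed
    then show "jacobi_gram s t x y n i j =
        (\<Sum>p<Suc n. \<Sum>q<Suc n. jacobi s t x i p * ?D p q * jacobi s t y j q)"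
      by (simp add: jacobi_gram_def lessThan_Suc_atMost del: sum.lessThan_Suc)
  qed
  ultimately have "det (mat (Suc n) (Suc n) (\<lambda>(i, j). jacobi_gram s t x y (Suc n) i j)) =
      jacobi_det s t x (Suc n) * (\<Prod>k<Suc n. weight t k) * jacobi_det s t y (Suc n) +
      weight t (Suc n) * det (mat n n (\<lambda>(i, j). jacobi_gram s t x y n i j))"
    by (simp only: det_corner det_sandwich det_diagonal jacobi_det_def)
  then show ?thesis
    by (simp only: mult_ac)
qed

text \<open>In \<open>weight t (Suc n) = weight t n * t n\<close> the first factor completes the
  product of weights and \<open>t n\<close> lengthens each product over \<open>l\<close>; the square
  part supplies the summand \<open>j = n + 1\<close>.\<close>

lemma det_jacobi_gram:
  "det (mat n n (\<lambda>(i, j). jacobi_gram s t x y n i j)) =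
     (\<Prod>k<n. weight t k) *
     (\<Sum>j = 0..n. jacobi_det s t x j * jacobi_det s t y j * (\<Prod>l = j..<n. t l))"
proof (induction n)
  case (Suc n)
  have "(\<Sum>j = 0..n. jacobi_det s t x j * jacobi_det s t y j * (\<Prod>l = j..<Suc n. t l)) =
      (\<Sum>j = 0..n. jacobi_det s t x j * jacobi_det s t y j * (\<Prod>l = j..<n. t l)) * t n"
    by (simp add: sum_distrib_right mult.assoc)
  then show ?case
    by (simp add: det_jacobi_gram_Suc Suc.IH algebra_simps)
qed simp

subsection \<open>Moments\<close>

lemma motzkin_neg: "k < 0 \<Longrightarrow> motzkin s t n k = 0"
  by (cases n) auto

lemma motzkin_eq_0: "int n < k \<Longrightarrow> motzkin s t n k = 0"
  by (induction n arbitrary: k) auto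

lemma motzkin_diag: "motzkin s t n (int n) = 1"
  by (induction n) (auto simp: motzkin_eq_0)

lemma motzkin_Suc_0:
  "motzkin s t (Suc n) 0 = s 0 * motzkin s t n 0 + t 0 * motzkin s t n 1"
  by (simp add: motzkin_neg)

text \<open>With \<open>motzkin_Suc_0\<close> this replaces the defining recurrence by one at
  natural heights.\<close>

lemma motzkin_Suc_Suc:
  "motzkin s t (Suc n) (int (Suc k)) =
     motzkin s t n (int k) + s (Suc k) * motzkin s t n (int (Suc k)) +
     t (Suc k) * motzkin s t n (int (Suc (Suc k)))"
  by (simp add: nat_add_distrib algebra_simps)

declare motzkin.simps(2) [simp del]

lemma det_motzkin:
  "det (mat n n (\<lambda>(i, j). motzkin s t i (int j))) = 1"
  by (subst det_lower_triangular [of n])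
    (auto simp: prod_list_diag_prod motzkin_eq_0 motzkin_diag)

text \<open>Self-adjointness of \<open>J\<close> for \<open>D\<close> as a summation by parts:
  horizontal steps cancel, up-steps and down-steps telescope, and only a boundary term at height
  \<open>N\<close> remains.\<close>

lemma motzkin_adjoint_boundary:
  "(\<Sum>k\<le>N. motzkin s t (Suc i) (int k) * motzkin s t j (int k) * weight t k) -
   (\<Sum>k\<le>N. motzkin s t i (int k) * motzkin s t (Suc j) (int k) * weight t k) =
   (motzkin s t i (int (Suc N)) * motzkin s t j (int N) -
    motzkin s t i (int N) * motzkin s t j (int (Suc N))) * weight t (Suc N)"
proof (induction N)
  case 0
  then show ?case by (simp add: motzkin_Suc_0 algebra_simps)
next
  case (Suc N)
  then show ?case
    by (simp add: motzkin_Suc_Suc algebra_simps del: of_nat_Suc)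
qed

text \<open>Cut a path of length \<open>i + j\<close> after \<open>i\<close> steps, at height
  \<open>k\<close>; reversing the second piece accounts for \<open>weight t k\<close>. The proof
  moves steps from \<open>j\<close> to \<open>i\<close> by self-adjointness.\<close>

lemma moment_add:
  assumes "i < n" "j < n"
  shows "moment s t (i + j) =
    (\<Sum>k<n. motzkin s t i (int k) * motzkin s t j (int k) * weight t k)"
proof -
  \<comment> \<open>The bound involves only \<open>i + j\<close>, which the induction preserves, and
    it makes the boundary term vanish.\<close>
  have *: "(\<Sum>k\<le>N. motzkin s t i (int k) * motzkin s t j (int k) * weight t k) = moment s t (i + j)"
    if "i + j \<le> N" for i j N
    using that
  proof (induction j arbitrary: i)
    case 0
    have "(\<Sum>k\<le>N. motzkin s t i (int k) * motzkin s t 0 (int k) * weight t k) =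
        (\<Sum>k\<le>N. if k = 0 then motzkin s t i 0 else 0)"
      by (rule sum.cong) auto
    then show ?case by (simp add: moment_def)
  next
    case (Suc j)
    have "(\<Sum>k\<le>N. motzkin s t i (int k) * motzkin s t (Suc j) (int k) * weight t k) =
        (\<Sum>k\<le>N. motzkin s t (Suc i) (int k) * motzkin s t j (int k) * weight t k)"
      using motzkin_adjoint_boundary [of s t i j N] Suc.prems by (simp add: motzkin_eq_0)
    then show ?case using Suc by simp
  qed
  have "(\<Sum>k<n. motzkin s t i (int k) * motzkin s t j (int k) * weight t k) =
      (\<Sum>k\<le>i + j + n. motzkin s t i (int k) * motzkin s t j (int k) * weight t k)"
    by (rule sum.mono_neutral_left) (use assms in \<open>auto simp: motzkin_eq_0\<close>)
  then show ?thesis using * by simp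
qed

lemma det_moment:
  "det (mat n n (\<lambda>(i, j). moment s t (i + j))) = (\<Prod>k<n. weight t k)"
proof -
  let ?v = "\<lambda>i k. motzkin s t i (int k)"
  let ?D = "\<lambda>p q. if p = q then weight t p else 0"
  have "mat n n (\<lambda>(i, j). moment s t (i + j)) =
      mat n n (\<lambda>(i, j). \<Sum>p<n. \<Sum>q<n. ?v i p * ?D p q * ?v j q)"
  proof (rule eq_matI; clarsimp)
    fix i j assume ij: "i < n" "j < n"
    have "(\<Sum>q<n. ?v i p * ?D p q * ?v j q) = ?v i p * ?v j p * weight t p" if "p < n" for p
    proof -
      have "(\<Sum>q<n. ?v i p * ?D p q * ?v j q) =
          (\<Sum>q<n. if p = q then ?v i p * ?v j p * weight t p else 0)"
        by (rule sum.cong) auto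
      then show ?thesis using that by simp
    qed
    then show "moment s t (i + j) = (\<Sum>p<n. \<Sum>q<n. ?v i p * ?D p q * ?v j q)"
      by (simp add: moment_add [OF ij])
  qed
  then show ?thesis
    by (simp only: det_sandwich det_diagonal det_motzkin mult_1_left mult_1_right)
qed

subsection \<open>Passing to polynomials\<close>

interpretation konst: comm_ring_hom konst
  by unfold_locales (simp_all add: konst_def one_pCons)

interpretation map_konst: map_poly_comm_ring_hom konst ..

lemma konst_eq_0_iff: "konst c = 0 \<longleftrightarrow> c = 0"
  by (simp add: konst_def)

lemma konst_weight: "konst (weight t k) = weight (\<lambda>i. konst (t i)) k"
  by (simp add: weight_def konst.hom_prod)

text \<open>Both sides have the same recurrence and initial values.\<close>

lemma subst_f_poly:
  "subst_poly (f_poly s t n) x = jacobi_det (\<lambda>i. konst (s i)) (\<lambda>i. konst (t i)) x n"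
  by (induction s t n rule: f_poly.induct)
    (simp_all add: subst_poly_def jacobi_det_rec hom_distribs algebra_simps)

text \<open>The recurrence as a row identity: row \<open>i\<close> of \<open>V (J + x)\<close> is
  \<open>x\<close> times row \<open>i\<close> of \<open>V\<close> plus row \<open>i + 1\<close>. Row
  \<open>i\<close> is supported on \<open>p <= i\<close>, so \<open>p < n\<close> suffices for every
  \<open>k\<close>.\<close>

lemma konst_motzkin_shift:
  assumes "i < n"
  shows "x * konst (motzkin s t i (int k)) + konst (motzkin s t (Suc i) (int k)) =
    (\<Sum>p<n. konst (motzkin s t i (int p)) * jacobi (\<lambda>i. konst (s i)) (\<lambda>i. konst (t i)) x p k)"
proof -
  let ?V = "\<lambda>k. konst (motzkin s t i (int k))"
  let ?J = "jacobi (\<lambda>i. konst (s i)) (\<lambda>i. konst (t i)) x"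
  have zero: "?V p = 0" if "n \<le> p" for p
    using assms that by (simp add: motzkin_eq_0)
  have "(\<Sum>p<n. ?V p * ?J p k) =
      (\<Sum>p<n. (if p = k then ?V k * (x + konst (s k)) else 0) +
         (if Suc p = k then ?V p else 0) +
         (if p = Suc k then ?V (Suc k) * konst (t k) else 0))"
    by (rule sum.cong) (auto simp: jacobi_def)
  \<comment> \<open>The middle sum stays because it is empty for \<open>k = 0\<close>, where no
    up-step arrives.\<close>
  also have "\<dots> = ?V k * (x + konst (s k)) + (\<Sum>p<n. if Suc p = k then ?V p else 0) +
      ?V (Suc k) * konst (t k)"
    using zero by (simp add: sum.distrib del: of_nat_Suc)
  also have "\<dots> = x * ?V k + konst (motzkin s t (Suc i) (int k))"
  proof (cases k)
    case 0
    then show ?thesis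
      by (simp add: motzkin_Suc_0 konst.hom_add konst.hom_mult algebra_simps)
  next
    case (Suc l)
    have "(\<Sum>p<n. if Suc p = k then ?V p else 0) = ?V l"
      using Suc zero by simp
    then show ?thesis
      unfolding Suc motzkin_Suc_Suc
      by (simp add: konst.hom_add konst.hom_mult algebra_simps del: of_nat_Suc)
  qed
  finally show ?thesis ..
qed

text \<open>The left side is the \<open>D\<close>-product of \<open>x v_i + v_(i+1)\<close> and
  \<open>y v_j + v_(j+1)\<close>, where \<open>v_i\<close> is row \<open>i\<close> of
  \<open>V\<close>; both are rows shifted by \<open>J\<close>.\<close>

lemma moment_kernel:
  assumes "i < n" "j < n"
  shows "x * y * konst (moment s t (i + j)) + (x + y) * konst (moment s t (i + j + 1)) +
      konst (moment s t (i + j + 2)) =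
    (\<Sum>p<n. \<Sum>q<n. konst (motzkin s t i (int p)) *
       jacobi_gram (\<lambda>i. konst (s i)) (\<lambda>i. konst (t i)) x y n p q *
       konst (motzkin s t j (int q)))"
proof -
  let ?V = "\<lambda>i k. konst (motzkin s t i (int k))"
  let ?J = "jacobi (\<lambda>i. konst (s i)) (\<lambda>i. konst (t i))"
  let ?W = "weight (\<lambda>i. konst (t i))"
  \<comment> \<open>Row \<open>n\<close> occurs as a shifted row, hence the range up to
    \<open>n\<close> inclusive.\<close>
  have gram: "konst (moment s t (i' + j')) = (\<Sum>k\<le>n. ?V i' k * ?V j' k * ?W k)"
    if "i' \<le> n" "j' \<le> n" for i' j'
    using moment_add [of i' "Suc n" j' s t] that
    by (simp add: konst.hom_sum konst.hom_mult konst_weight lessThan_Suc_atMost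
        del: sum.lessThan_Suc)
  have "x * y * konst (moment s t (i + j)) + (x + y) * konst (moment s t (i + j + 1)) +
      konst (moment s t (i + j + 2)) =
      x * y * konst (moment s t (i + j)) + x * konst (moment s t (i + Suc j)) +
      y * konst (moment s t (Suc i + j)) + konst (moment s t (Suc i + Suc j))"
    by (simp add: algebra_simps)
  also have "\<dots> = (\<Sum>k\<le>n. (x * ?V i k + ?V (Suc i) k) * (y * ?V j k + ?V (Suc j) k) * ?W k)"
    using assms
    by (subst gram, simp, simp)+ (simp add: sum_distrib_left sum.distrib algebra_simps)
  also have "\<dots> = (\<Sum>k\<le>n. \<Sum>p<n. \<Sum>q<n. ?V i p * (?J x p k * ?J y q k * ?W k) * ?V j q)"
    unfolding konst_motzkin_shift [OF assms(1)] konst_motzkin_shift [OF assms(2)]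
    by (intro sum.cong refl, subst sum_product) (simp only: sum_distrib_left sum_distrib_right mult_ac)
  also have "\<dots> = (\<Sum>p<n. \<Sum>q<n. \<Sum>k\<le>n. ?V i p * (?J x p k * ?J y q k * ?W k) * ?V j q)"
    by (simp only: sum.swap [of _ "{..<n}" "{..n}"])
  finally show ?thesis
    by (simp only: jacobi_gram_def sum_distrib_left sum_distrib_right)
qed

text \<open>The claim with the denominator cleared, for arbitrary ring elements \<open>x\<close> and
  \<open>y\<close>; since \<open>det V = 1\<close>, only the Gram determinant remains.\<close>

lemma det_moment_kernel:
  "det (mat n n (\<lambda>(i, j). x * y * konst (moment s t (i + j)) +
      (x + y) * konst (moment s t (i + j + 1)) + konst (moment s t (i + j + 2)))) =
   konst (det (mat n n (\<lambda>(i, j). moment s t (i + j)))) *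
   (\<Sum>j = 0..n. subst_poly (f_poly s t j) x * subst_poly (f_poly s t j) y *
      (\<Prod>l = j..<n. konst (t l)))"
    (is "det ?K = _")
proof -
  let ?V = "\<lambda>i k. konst (motzkin s t i (int k))"
  let ?G = "jacobi_gram (\<lambda>i. konst (s i)) (\<lambda>i. konst (t i)) x y n"
  have "mat n n (\<lambda>(i, j). ?V i j) = map_mat konst (mat n n (\<lambda>(i, j). motzkin s t i (int j)))"
    by (rule eq_matI) auto
  then have V: "det (mat n n (\<lambda>(i, j). ?V i j)) = 1"
    by (simp add: det_motzkin)
  have "?K = mat n n (\<lambda>(i, j). \<Sum>p<n. \<Sum>q<n. ?V i p * ?G p q * ?V j q)"
    by (rule eq_matI) (use moment_kernel in auto)
  then have "det ?K = det (mat n n (\<lambda>(i, j). ?G i j))"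
    by (simp only: det_sandwich V mult_1_left mult_1_right)
  then show ?thesis
    by (simp add: det_jacobi_gram det_moment subst_f_poly konst.hom_prod konst_weight)
qed

theorem theorem1:
  fixes s t :: "nat \<Rightarrow> real" and n :: nat
  assumes t_nonzero: "\<And>i. t i \<noteq> 0"
    and n_pos: "n \<ge> 1"
  shows "det (mat n n (\<lambda>(i, j). moment s t (i + j))) \<noteq> 0 \<and>
    to_fract (det (mat n n (\<lambda>(i, j).
        ind_alpha * ind_beta * konst (moment s t (i + j))
        + (ind_alpha + ind_beta) * konst (moment s t (i + j + 1))
        + konst (moment s t (i + j + 2)))))
      / to_fract (konst (det (mat n n (\<lambda>(i, j). moment s t (i + j)))))
    = to_fract (\<Sum>j = 0..n. subst_poly (f_poly s t j) ind_alpha * subst_poly (f_poly s t j) ind_beta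
        * (\<Prod>l = j..<n. konst (t l)))"
proof
  show nz: "det (mat n n (\<lambda>(i, j). moment s t (i + j))) \<noteq> 0"
    \<comment> \<open>The Hankel determinant is a product of values of \<open>t\<close>.\<close>
    using t_nonzero by (simp add: det_moment weight_def)
  then show "to_fract (det (mat n n (\<lambda>(i, j).
        ind_alpha * ind_beta * konst (moment s t (i + j))
        + (ind_alpha + ind_beta) * konst (moment s t (i + j + 1))
        + konst (moment s t (i + j + 2)))))
      / to_fract (konst (det (mat n n (\<lambda>(i, j). moment s t (i + j)))))
    = to_fract (\<Sum>j = 0..n. subst_poly (f_poly s t j) ind_alpha * subst_poly (f_poly s t j) ind_beta
        * (\<Prod>l = j..<n. konst (t l)))"
    unfolding det_moment_kernel by (simp add: konst_eq_0_iff)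
qed

end
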